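(* Let $N=pN'$ be a square-free number with $p\in\mathbb{N}$ prime and $N'\in\mathbb{N}$ such that all principal minors of $\mathcal{F}_{N'}$ are non-zero in characteristic $p$. Then any $N'$-principal minor (and thus any principal minor) of $\mathcal{F}_N$ is non-zero (as a complex number).
   Context: For $N\in\mathbb{N}$, the Fourier matrix is $\mathcal{F}_N=(\omega^{ij})_{0\le i,j\le N-1}\in\mathbb{C}^{N\times N}$ with $\omega=e^{-2\pi i/N}$, rows and columns indexed by $\mathbb{Z}_N=\{0,\dots,N-1\}$. For $K,L\subset\mathbb{Z}_N$ with $|K|=|L|$, $\mathcal{F}_N[K,L]$ is the submatrix with rows indexed by $K$ and columns indexed by $L$; the corresponding minor is its determinant. The minor is principal if $K=L$. For a divisor $d$ of $N$, it is $d$-principal if $|\{k\in K: k\equiv i \bmod d\}|=|\{\ell\in L:\ell\equiv i\bmod d\}|$ for all $0\le i\le d-1$. Fourier matrix in characteristic $q$: for a prime $q$ with $q\nmid n$, let $f=\mathrm{ord}_n(q)$ be the multiplicative order of $q$ modulo $n$, fix a primitive $n$-th root of unity $\zeta\in\mathbb{F}_{q^f}$ and put $\overline{\mathcal{F}}_n=(\zeta^{ij})_{0\le i,j\le n-1}$ (equivalently, reduce the entries of $\mathcal{F}_n$ modulo a prime ideal of $\mathbb{Z}[e^{-2\pi i/n}]$ above $q$). Saying that all principal minors of $\mathcal{F}_n$ are non-zero in characteristic $q$ means that $\det\overline{\mathcal{F}}_n[K,K]\neq0$ in $\mathbb{F}_{q^f}$ for all $K\subset\mathbb{Z}_n$.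 *)

theory Defs
  imports
    Complex_Main
    "HOL-Library.Cardinality"
    "HOL-Computational_Algebra.Squarefree"
    "HOL-Number_Theory.Residues"
    "HOL-Number_Theory.Pocklington"
    Jordan_Normal_Form.Determinant
    Jordan_Normal_Form.DL_Submatrix
begin

definition primitive_root_of_unity :: "nat \<Rightarrow> 'a::field \<Rightarrow> bool" where
  "primitive_root_of_unity n z \<longleftrightarrow> z ^ n = 1 \<and> (\<forall>k. 0 < k \<and> k < n \<longrightarrow> z ^ k \<noteq> 1)"

definition fourier_matrix_of :: "nat \<Rightarrow> 'a::field \<Rightarrow> 'a mat" where
  "fourier_matrix_of n z = mat n n (\<lambda>(i, j). z ^ (i * j))"

definition fourier_matrix :: "nat \<Rightarrow> complex mat" where
  "fourier_matrix n = fourier_matrix_of n (exp (- 2 * of_real pi * \<i> / of_nat n))"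

text \<open>
  The library's \<^term>\<open>submatrix A K L\<close> lists the selected rows and columns in increasing order.
  It is used only for index sets contained in \<^term>\<open>{0..<n}\<close> and of equal cardinality.
\<close>

definition minor :: "'a::comm_ring_1 mat \<Rightarrow> nat set \<Rightarrow> nat set \<Rightarrow> 'a" where
  "minor A K L = det (submatrix A K L)"

definition d_principal :: "nat \<Rightarrow> nat set \<Rightarrow> nat set \<Rightarrow> bool" where
  "d_principal d K L \<longleftrightarrow>
     (\<forall>i<d. card {k \<in> K. [k = i] (mod d)} = card {l \<in> L. [l = i] (mod d)})"

end

(* Chinese remaindering writes \<omega>^(kl) as \<alpha>^(kl) \<beta>^(kl), where \<alpha> has order p and \<beta> has order N'.
  If w is in the kernel of the minor over the complex numbers, then for every residue r modulo N'
  the polynomial H_r, the sum of \<beta>^(rl) w_l X^(l mod p) over l in L, vanishes at \<alpha>^k for all k in K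
  congruent to r, so it is divisible by the product G_r of the X - \<alpha>^k. Taking remainders modulo G_r,
  this says that a square matrix over Z[\<omega>] is singular. Its determinant stays zero after reduction
  modulo a prime above p, where \<omega> goes to \<zeta>, \<alpha> to 1 and G_r to (X - 1)^(n_r). A kernel vector of the
  reduced matrix gives polynomials h_s of degree below p with at most n_s terms such that
  (X - 1)^(n_r) divides the sum over s of \<zeta>^(rs) h_s. In characteristic p a non-zero h_s vanishes at 1
  to order less than n_s. If m is the least order among the h_s, the values of h_s / (X - 1)^m at 1 are
  supported on R = {r. n_r > m} and lie in the kernel of the principal minor on R, a contradiction. *)

theory Submission
  imports Defs "Jordan_Normal_Form.Char_Poly"
begin

section \<open>Kernels of square systems\<close>

text \<open>Only the vanishing of the determinant matters, so the enumerations \<open>f\<close> and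
  \<open>g\<close> may be arbitrary. Kernel vectors become functions on \<open>L\<close>, which
  frees later arguments from matrix indices.\<close>

lemma det_eq_0_iff_kernel:
  fixes c :: "'a \<Rightarrow> 'b \<Rightarrow> 'c::field"
  assumes f: "bij_betw f {0..<n} S" and g: "bij_betw g {0..<n} L"
  shows "det (mat n n (\<lambda>(i, j). c (f i) (g j))) = 0 \<longleftrightarrow>
    (\<exists>w. (\<exists>l\<in>L. w l \<noteq> 0) \<and> (\<forall>s\<in>S. (\<Sum>l\<in>L. c s l * w l) = 0))"
proof -
  define A where "A = mat n n (\<lambda>(i, j). c (f i) (g j))"
  have A: "A \<in> carrier_mat n n" by (simp add: A_def)
  have L: "L = g ` {0..<n}" and S: "S = f ` {0..<n}"
    using f g by (auto simp: bij_betw_def)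
  have ker: "A *\<^sub>v v = 0\<^sub>v n \<longleftrightarrow> (\<forall>s\<in>S. (\<Sum>l\<in>L. c s l * w l) = 0)"
    if v: "v = vec n (\<lambda>j. w (g j))" for v w
  proof -
    have "(A *\<^sub>v v) $ i = (\<Sum>l\<in>L. c (f i) l * w l)" if "i < n" for i
    proof -
      have "(\<Sum>l\<in>L. c (f i) l * w l) = (\<Sum>j\<in>{0..<n}. c (f i) (g j) * w (g j))"
        by (rule sum.reindex_bij_betw[OF g, symmetric])
      thus ?thesis using that by (simp add: A_def v scalar_prod_def)
    qed
    moreover have "A *\<^sub>v v = 0\<^sub>v n \<longleftrightarrow> (\<forall>i<n. (A *\<^sub>v v) $ i = 0)"
      using A by (auto simp: vec_eq_iff)
    ultimately show ?thesis by (auto simp: S)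
  qed
  have "det A = 0 \<longleftrightarrow> (\<exists>v. v \<in> carrier_vec n \<and> v \<noteq> 0\<^sub>v n \<and> A *\<^sub>v v = 0\<^sub>v n)"
    by (rule det_0_iff_vec_prod_zero_field[OF A])
  also have "\<dots> \<longleftrightarrow> (\<exists>w. (\<exists>l\<in>L. w l \<noteq> 0) \<and> (\<forall>s\<in>S. (\<Sum>l\<in>L. c s l * w l) = 0))"
  proof
    assume "\<exists>v. v \<in> carrier_vec n \<and> v \<noteq> 0\<^sub>v n \<and> A *\<^sub>v v = 0\<^sub>v n"
    then obtain v where v: "v \<in> carrier_vec n" "v \<noteq> 0\<^sub>v n" "A *\<^sub>v v = 0\<^sub>v n" by blast
    define w where "w l = v $ inv_into {0..<n} g l" for l
    have wg: "w (g j) = v $ j" if "j < n" for j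
      using that g by (simp add: w_def bij_betw_def inv_into_f_f)
    have v': "v = vec n (\<lambda>j. w (g j))"
      using v(1) by (intro eq_vecI) (auto simp: wg)
    obtain j where "j < n" "v $ j \<noteq> 0"
      using v(1,2) by (auto simp: vec_eq_iff)
    hence "\<exists>l\<in>L. w l \<noteq> 0" using wg by (auto simp: L)
    thus "\<exists>w. (\<exists>l\<in>L. w l \<noteq> 0) \<and> (\<forall>s\<in>S. (\<Sum>l\<in>L. c s l * w l) = 0)"
      using ker[OF v'] v(3) by blast
  next
    assume "\<exists>w. (\<exists>l\<in>L. w l \<noteq> 0) \<and> (\<forall>s\<in>S. (\<Sum>l\<in>L. c s l * w l) = 0)"
    then obtain w l where w: "l \<in> L" "w l \<noteq> 0" "\<forall>s\<in>S. (\<Sum>l\<in>L. c s l * w l) = 0" by blast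
    define v where "v = vec n (\<lambda>j. w (g j))"
    have "v \<noteq> 0\<^sub>v n"
    proof
      assume z: "v = 0\<^sub>v n"
      obtain j where j: "j < n" "l = g j" using w(1) by (auto simp: L)
      have "v $ j = w l" using j by (simp add: v_def)
      with z j w(2) show False by simp
    qed
    moreover have "v \<in> carrier_vec n" by (simp add: v_def)
    ultimately show "\<exists>v. v \<in> carrier_vec n \<and> v \<noteq> 0\<^sub>v n \<and> A *\<^sub>v v = 0\<^sub>v n"
      using ker[OF v_def] w(3) by blast
  qed
  finally show ?thesis by (simp add: A_def)
qed

lemma bij_betw_pick:
  assumes "finite S"
  shows "bij_betw (pick S) {0..<card S} S"
proof -
  have "inj_on (pick S) {0..<card S}"
    by (rule linorder_inj_onI) (use pick_mono_le[of _ S] in \<open>fastforce+\<close>)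
  moreover have "pick S ` {0..<card S} \<subseteq> S"
    by (auto intro: pick_in_set_le)
  ultimately show ?thesis
    using card_subset_eq[OF assms] by (simp add: bij_betw_def card_image)
qed

lemma minor_eq_0_iff_kernel:
  fixes A :: "'a::field mat"
  assumes A: "A \<in> carrier_mat m m'" and K: "K \<subseteq> {0..<m}" and L: "L \<subseteq> {0..<m'}"
    and card: "card K = card L"
  shows "minor A K L = 0 \<longleftrightarrow>
    (\<exists>w. (\<exists>l\<in>L. w l \<noteq> 0) \<and> (\<forall>k\<in>K. (\<Sum>l\<in>L. A $$ (k, l) * w l) = 0))"
proof -
  have fin: "finite K" "finite L" using K L by (auto intro: finite_subset)
  have K': "{i. i < dim_row A \<and> i \<in> K} = K" and L': "{j. j < dim_col A \<and> j \<in> L} = L"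
    using A K L by auto
  have "submatrix A K L = mat (card L) (card L) (\<lambda>(i, j). A $$ (pick K i, pick L j))"
    by (rule eq_matI) (simp_all add: submatrix_index K' L' card dim_submatrix)
  moreover have "bij_betw (pick K) {0..<card L} K"
    using bij_betw_pick[OF fin(1)] card by simp
  ultimately show ?thesis
    unfolding minor_def
    using det_eq_0_iff_kernel[of "pick K" "card L" K "pick L" L "\<lambda>k l. A $$ (k, l)"]
      bij_betw_pick[OF fin(2)] by simp
qed

text \<open>The determinant of the square system is a single element of the common ring. It is
  killed by \<phi>, hence by \<psi>, and the image system is singular again. Equal cardinalities of
  \<open>S\<close> and \<open>L\<close> are what makes a determinant available.\<close>

lemma kernel_transfer:
  fixes \<phi> :: "'r::comm_ring_1 \<Rightarrow> 'a::field" and \<psi> :: "'r \<Rightarrow> 'b::field"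
    and c :: "'s \<Rightarrow> 'l \<Rightarrow> 'r"
  assumes \<phi>: "comm_ring_hom \<phi>" and \<psi>: "comm_ring_hom \<psi>"
    and ker: "\<And>r. \<phi> r = 0 \<Longrightarrow> \<psi> r = 0"
    and fin: "finite S" "finite L" and card: "card S = card L"
    and w: "l0 \<in> L" "w l0 \<noteq> 0" "\<And>s. s \<in> S \<Longrightarrow> (\<Sum>l\<in>L. \<phi> (c s l) * w l) = 0"
  obtains v where "\<exists>l\<in>L. v l \<noteq> 0" "\<And>s. s \<in> S \<Longrightarrow> (\<Sum>l\<in>L. \<psi> (c s l) * v l) = 0"
proof -
  obtain f where f: "bij_betw f {0..<card L} S"
    using ex_bij_betw_nat_finite[OF fin(1)] card by auto
  obtain g where g: "bij_betw g {0..<card L} L"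
    using ex_bij_betw_nat_finite[OF fin(2)] by auto
  define C where "C = mat (card L) (card L) (\<lambda>(i, j). c (f i) (g j))"
  have map: "map_mat h C = mat (card L) (card L) (\<lambda>(i, j). h (c (f i) (g j)))" for h :: "'r \<Rightarrow> 'z"
    by (rule eq_matI) (simp_all add: C_def)
  have "\<phi> (det C) = det (map_mat \<phi> C)"
    by (rule comm_ring_hom.hom_det[OF \<phi>, symmetric])
  also have "\<dots> = 0"
    unfolding map using det_eq_0_iff_kernel[OF f g, of "\<lambda>s l. \<phi> (c s l)"] w by blast
  finally have "det (map_mat \<psi> C) = 0"
    using ker comm_ring_hom.hom_det[OF \<psi>, of C] by simp
  thus ?thesis
    unfolding map using det_eq_0_iff_kernel[OF f g, of "\<lambda>s l. \<psi> (c s l)"] that by blast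
qed

section \<open>Integer polynomials at roots of unity\<close>

text \<open>The ring of integer polynomials stands in for Z[\<omega>]: reduction modulo a prime
  becomes the passage from evaluation at \<omega> to evaluation at \<zeta>.\<close>

definition int_poly_eval :: "'a::comm_ring_1 \<Rightarrow> int poly \<Rightarrow> 'a" where
  "int_poly_eval x P = poly (of_int_poly P) x"

lemma comm_ring_hom_int_poly_eval: "comm_ring_hom (int_poly_eval x)"
  unfolding int_poly_eval_def
  by (unfold_locales) (simp_all add: hom_distribs)

interpretation int_poly_eval: comm_ring_hom "int_poly_eval x" for x
  by (rule comm_ring_hom_int_poly_eval)

lemma int_poly_eval_monom [simp]: "int_poly_eval x (monom a k) = of_int a * x ^ k"
  by (simp add: int_poly_eval_def poly_monom)

lemma int_poly_eval_smult [simp]: "int_poly_eval x (smult a P) = of_int a * int_poly_eval x P"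
  by (simp add: int_poly_eval_def hom_distribs)

lemma int_poly_eval_pcompose_monom:
  "int_poly_eval x (P \<circ>\<^sub>p monom 1 k) = int_poly_eval (x ^ k) P"
proof (induction P)
  case (pCons a P)
  thus ?case
    by (simp add: pcompose_pCons hom_distribs) (simp add: int_poly_eval_def hom_distribs)
qed (simp add: int_poly_eval_def)

section \<open>Minimal polynomials of algebraic integers\<close>

lemma monic_division:
  fixes f g :: "'a::idom poly"
  assumes "lead_coeff g = 1"
  obtains q r where "f = g * q + r" "r = 0 \<or> degree r < degree g"
proof -
  have "g \<noteq> 0" using assms by auto
  moreover obtain q r where "pseudo_divmod f g = (q, r)" by fastforce
  ultimately show ?thesis using pseudo_divmod[of g f q r] assms that by simp
qed

text \<open>Take the primitive part of a non-zero integer polynomial of least degree vanishing at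
  \<open>x\<close>. Pseudo-division gives divisibility up to an integer factor, and Gauss's lemma
  removes that factor.\<close>

lemma monic_int_minimal_poly:
  fixes x :: "'a::field_char_0"
  assumes g: "lead_coeff g = 1" "int_poly_eval x g = 0"
  obtains f where "lead_coeff f = 1" "int_poly_eval x f = 0"
    "\<And>P. int_poly_eval x P = 0 \<Longrightarrow> f dvd P"
proof -
  define Q where "Q f \<longleftrightarrow> f \<noteq> 0 \<and> int_poly_eval x f = 0" for f :: "int poly"
  have "Q g" using g by (auto simp: Q_def)
  then obtain f0 where f0: "Q f0" "\<And>f. Q f \<Longrightarrow> degree f0 \<le> degree f"
    using ex_has_least_nat[of Q g degree] by blast
  define f1 where "f1 = primitive_part f0"
  have "f0 \<noteq> 0" using f0 by (simp add: Q_def)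
  hence f1: "f1 \<noteq> 0" "degree f1 = degree f0" "content f1 = 1"
    by (simp_all add: f1_def)
  have "of_int (content f0) * int_poly_eval x f1 = 0"
    using f0(1) by (simp flip: int_poly_eval_smult add: f1_def Q_def)
  moreover have "content f0 \<noteq> 0" using \<open>f0 \<noteq> 0\<close> by simp
  ultimately have f1x: "int_poly_eval x f1 = 0" by simp
  have dvd: "f1 dvd P" if P: "int_poly_eval x P = 0" for P
  proof -
    define r where "r = pseudo_mod P f1"
    obtain a q where a: "a \<noteq> 0" "smult a P = f1 * q + r"
      using pseudo_mod(1)[OF f1(1)] unfolding r_def by blast
    have r: "r = 0 \<or> degree r < degree f1"
      using pseudo_mod(2)[OF f1(1)] unfolding r_def by blast
    have "int_poly_eval x (smult a P) = int_poly_eval x (f1 * q + r)" using a by simp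
    hence "int_poly_eval x r = 0" by (simp add: P f1x hom_distribs)
    hence "r = 0" using f0(2)[of r] r f1(2) by (metis Q_def leD)
    hence "f1 dvd smult a P" using a by simp
    \<comment> \<open>Passing to primitive parts cancels \<open>a\<close> up to its sign, which is
      \<open>unit_factor a\<close>.\<close>
    hence "primitive_part f1 dvd smult (unit_factor a) (primitive_part P)"
      by (metis primitive_part_dvd_primitive_partI primitive_part_smult)
    hence "f1 dvd smult (unit_factor a) (primitive_part P)"
      using f1(3) by (simp add: primitive_part_prim)
    hence "f1 dvd smult (content P) (smult (unit_factor a) (primitive_part P))"
      by (rule dvd_smult)
    also have "\<dots> = smult (unit_factor a) P"
      by (metis content_times_primitive_part mult.commute smult_smult)
    finally have "f1 dvd smult (unit_factor a * unit_factor a) P"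
      by (metis dvd_smult smult_smult)
    moreover have "unit_factor a * unit_factor a = 1" using a(1) by (simp add: sgn_if)
    ultimately show ?thesis by simp
  qed
  \<comment> \<open>\<open>f1\<close> divides the monic \<open>g\<close>, so \<open>u\<close> is 1
    or -1, and scaling by \<open>u\<close> makes \<open>f1\<close> monic.\<close>
  define u where "u = lead_coeff f1"
  obtain h where "g = f1 * h" using dvd[OF g(2)] by (auto elim: dvdE)
  hence "u * lead_coeff h = 1" using g(1) by (simp add: u_def lead_coeff_mult)
  hence uu: "u * u = 1" by (auto simp: zmult_eq_1_iff)
  show ?thesis
  proof (rule that[of "smult u f1"])
    show "lead_coeff (smult u f1) = 1" using uu f1(1) by (simp add: u_def)
    show "int_poly_eval x (smult u f1) = 0" using f1x by simp
    fix P assume "int_poly_eval x P = 0"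
    hence "smult u (smult u f1) dvd P" using dvd uu by simp
    thus "smult u f1 dvd P" by (metis dvd_trans dvd_smult dvd_refl)
  qed
qed

section \<open>Frobenius congruences and conjugates of a root of unity\<close>

lemma prime_dvd_power_add:
  fixes a b :: "'a::comm_ring_1"
  assumes "prime q"
  shows "of_nat q dvd (a + b) ^ q - (a ^ q + b ^ q)"
proof -
  have "q > 0" using assms prime_gt_0_nat by blast
  have "(a + b) ^ q = (\<Sum>k\<le>q. of_nat (q choose k) * a ^ k * b ^ (q - k))"
    by (rule binomial_ring)
  also have "{..q} = insert 0 (insert q {0<..<q})" using \<open>q > 0\<close> by auto
  finally have "(a + b) ^ q - (a ^ q + b ^ q)
      = (\<Sum>k\<in>{0<..<q}. of_nat (q choose k) * a ^ k * b ^ (q - k))"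
    using \<open>q > 0\<close> by simp
  moreover have "of_nat q dvd (of_nat (q choose k) :: 'a)" if "k \<in> {0<..<q}" for k
    using that assms dvd_choose_prime[of k q] \<open>q > 0\<close>
    by (auto elim!: dvdE)
  ultimately show ?thesis by (auto intro!: dvd_sum simp: mult.assoc)
qed

lemma prime_dvd_power_diff_self_int:
  assumes "prime q"
  shows "int q dvd a ^ q - a"
proof (cases "int q dvd a")
  case True
  moreover have "q > 0" using assms prime_gt_0_nat by blast
  ultimately show ?thesis by (metis dvd_diff dvd_power dvd_trans)
next
  case False
  define b where "b = nat (a mod int q)"
  have q: "q > 0" using assms prime_gt_0_nat by blast
  have b: "int b = a mod int q" using q by (simp add: b_def)
  hence ab: "[a = int b] (mod int q)" by (simp add: cong_def)
  have "\<not> q dvd b" using False b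
    by (metis dvd_mod_iff dvd_refl int_dvd_int_iff)
  hence "[b ^ (q - 1) = 1] (mod q)" using fermat_theorem assms by blast
  hence "[b ^ (q - 1) * b = 1 * b] (mod q)" by (rule cong_mult) auto
  hence "[b ^ q = b] (mod q)" using q by (simp flip: power_Suc2)
  hence "[int b ^ q = int b] (mod int q)" by (metis cong_int_iff of_nat_power)
  hence "[a ^ q = a] (mod int q)" using ab
    by (meson cong_pow cong_sym cong_trans)
  thus ?thesis by (simp add: cong_iff_dvd_diff)
qed

text \<open>Induction on the coefficients: the constant term is handled by Fermat's little theorem,
  the splitting off of that term by the binomial congruence modulo \<open>q\<close>.\<close>

lemma int_poly_frobenius:
  fixes f :: "int poly"
  assumes "prime q"
  shows "[:int q:] dvd f \<circ>\<^sub>p monom 1 q - f ^ q"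
proof (induction f)
  case 0
  thus ?case using prime_gt_0_nat[OF assms] by (simp add: power_0_left)
next
  case (pCons a f)
  have of_nat: "(of_nat q :: int poly) = [:int q:]" by (simp add: of_nat_poly)
  define u v where "u = [:a:]" and "v = monom 1 1 * f"
  have uv: "pCons a f = u + v"
    by (simp add: u_def v_def monom_Suc)
  have "pCons a f \<circ>\<^sub>p monom 1 q - pCons a f ^ q
     = (u - u ^ q) + monom 1 q * (f \<circ>\<^sub>p monom 1 q - f ^ q) - ((u + v) ^ q - (u ^ q + v ^ q))"
    by (simp add: uv[symmetric] pcompose_pCons)
       (simp add: u_def v_def power_mult_distrib monom_power algebra_simps)
  moreover have "[:int q:] dvd u - u ^ q"
  proof -
    have "int q dvd a - a ^ q"
      using prime_dvd_power_diff_self_int[OF assms] by (metis dvd_minus_iff minus_diff_eq)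
    thus ?thesis by (auto simp: u_def poly_const_pow elim!: dvdE intro!: dvdI[of _ _ "[:_:]"])
  qed
  moreover have "[:int q:] dvd (u + v) ^ q - (u ^ q + v ^ q)"
    using prime_dvd_power_add[OF assms, of u v] by (simp add: of_nat)
  ultimately show ?case using pCons.IH by (metis dvd_add dvd_diff dvd_mult)
qed

lemma dvd_pcompose_diff:
  fixes f a b :: "'a::comm_ring_1 poly"
  shows "a - b dvd f \<circ>\<^sub>p a - f \<circ>\<^sub>p b"
proof (induction f)
  case (pCons c f)
  have "pCons c f \<circ>\<^sub>p a - pCons c f \<circ>\<^sub>p b
    = (a - b) * (f \<circ>\<^sub>p a) + b * (f \<circ>\<^sub>p a - f \<circ>\<^sub>p b)"
    by (simp add: pcompose_pCons algebra_simps)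
  thus ?case using pCons.IH by (metis dvd_add dvd_mult dvd_triv_left)
qed simp

lemma monom_diff_one_dvd:
  fixes k N :: nat
  shows "(monom 1 N - 1 :: 'a::comm_ring_1 poly) dvd monom 1 k - monom 1 (k mod N)"
proof -
  have "(monom 1 N - 1 :: 'a poly) dvd (monom 1 N) ^ (k div N) - 1 ^ (k div N)"
    by (metis dvd_triv_left power_diff_sumr2)
  hence "(monom 1 N - 1 :: 'a poly) dvd monom 1 (k mod N) * (monom 1 (N * (k div N)) - 1)"
    by (simp add: monom_power)
  also have "\<dots> = monom 1 k - (monom 1 (k mod N) :: 'a poly)"
    by (simp add: algebra_simps mult_monom)
  finally show ?thesis .
qed

text \<open>The remainders of \<^term>\<open>f \<circ>\<^sub>p monom 1 q\<close> modulo \<^term>\<open>f\<close> take finitely many values, and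
  for prime \<^term>\<open>q\<close> they are divisible by \<^term>\<open>q\<close>, so they vanish for large \<^term>\<open>q\<close>.\<close>

lemma dvd_pcompose_monom_large_prime:
  fixes f :: "int poly"
  assumes monic: "lead_coeff f = 1" and dvd: "f dvd monom 1 N - 1" and N: "N > 0"
  obtains A where "\<And>q. prime q \<Longrightarrow> q > A \<Longrightarrow> f dvd f \<circ>\<^sub>p monom 1 q"
proof -
  have "\<exists>r. f dvd f \<circ>\<^sub>p monom 1 j - r \<and> (r = 0 \<or> degree r < degree f)" for j
    by (rule monic_division[OF monic, of "f \<circ>\<^sub>p monom 1 j"]) (metis add_diff_cancel_right' dvd_triv_left)
  then obtain R where R: "\<And>j. f dvd f \<circ>\<^sub>p monom 1 j - R j"
    and deg: "\<And>j. R j = 0 \<or> degree (R j) < degree f" by metis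
  have "finite ((\<lambda>(j, i). nat \<bar>coeff (R j) i\<bar>) ` ({..<N} \<times> {..degree f}))" by simp
  then obtain A where A: "\<forall>x \<in> (\<lambda>(j, i). nat \<bar>coeff (R j) i\<bar>) ` ({..<N} \<times> {..degree f}). x \<le> A"
    using finite_nat_set_iff_bounded_le by blast
  show ?thesis
  proof (rule that[of A])
    fix q :: nat assume q: "prime q" "q > A"
    define j where "j = q mod N"
    have j: "j < N" using N by (simp add: j_def)
    \<comment> \<open>Since \<open>f\<close> divides \<open>X^N - 1\<close>, the remainder depends
      only on \<open>q mod N\<close>.\<close>
    have "f dvd monom 1 q - monom 1 j"
      using dvd monom_diff_one_dvd[of N q] dvd_trans unfolding j_def by blast
    hence 1: "f dvd f \<circ>\<^sub>p monom 1 q - f \<circ>\<^sub>p monom 1 j"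
      using dvd_pcompose_diff dvd_trans by blast
    obtain h where "f \<circ>\<^sub>p monom 1 q - f ^ q = [:int q:] * h"
      using int_poly_frobenius[OF q(1)] by (metis dvdE)
    hence h: "f \<circ>\<^sub>p monom 1 q = f ^ q + smult (int q) h" by (simp add: algebra_simps)
    obtain Q S where S: "h = f * Q + S" "S = 0 \<or> degree S < degree f"
      by (rule monic_division[OF monic])
    have "f dvd f ^ q" using prime_gt_0_nat[OF q(1)] by (simp add: dvd_power)
    moreover have "f dvd smult (int q) (f * Q)" by (intro dvd_smult) simp
    ultimately have "f dvd f ^ q + smult (int q) (f * Q)" by (rule dvd_add)
    moreover have "f \<circ>\<^sub>p monom 1 q - smult (int q) S = f ^ q + smult (int q) (f * Q)"
      unfolding h S(1) smult_add_right by simp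
    ultimately have 2: "f dvd f \<circ>\<^sub>p monom 1 q - smult (int q) S" by (simp only:)
    \<comment> \<open>\<open>R j\<close> and \<open>smult (int q) S\<close> are remainders of the
      same polynomial modulo the monic \<open>f\<close>, so they agree.\<close>
    have "f dvd (f \<circ>\<^sub>p monom 1 q - smult (int q) S) - (f \<circ>\<^sub>p monom 1 q - f \<circ>\<^sub>p monom 1 j)
        - (f \<circ>\<^sub>p monom 1 j - R j)"
      by (intro dvd_diff 1 2 R)
    also have "\<dots> = R j - smult (int q) S" by simp
    finally have dvd': "f dvd R j - smult (int q) S" .
    have deg': "R j - smult (int q) S = 0 \<or> degree (R j - smult (int q) S) < degree f"
      using deg[of j] S(2) by (auto intro!: degree_diff_less)
    have RS: "R j = smult (int q) S"
      using dvd_imp_degree_le[OF dvd'] deg' by fastforce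
    have "coeff (R j) i = 0" for i
    proof (cases "i \<le> degree f")
      case True
      hence "nat \<bar>coeff (R j) i\<bar> \<le> A" using A j by auto
      hence "\<bar>coeff (R j) i\<bar> < int q" using q(2) by linarith
      moreover have "int q dvd coeff (R j) i" by (simp add: RS)
      ultimately show ?thesis by (metis dvd_imp_le_int linorder_not_less abs_of_nat)
    next
      case False
      thus ?thesis using deg[of j] by (auto simp: coeff_eq_0)
    qed
    hence "R j = 0" by (simp add: poly_eq_iff)
    thus "f dvd f \<circ>\<^sub>p monom 1 q" using dvd_add[OF 1 R[of j]] by simp
  qed
qed

text \<open>The witness is \<open>k + N * \<Prod>Q\<close>, where \<open>Q\<close> collects the
  primes up to \<open>A\<close> not dividing \<open>k\<close>. A prime up to \<open>A\<close>
  divides exactly one of the two summands: those in \<open>Q\<close> miss \<open>k\<close>, and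
  those dividing \<open>k\<close> miss both \<open>N\<close> and \<open>\<Prod>Q\<close>.\<close>

lemma coprime_cong_large_prime_factors:
  fixes k N A :: nat
  assumes "coprime k N" "N > 0"
  obtains k' where "[k' = k] (mod N)" "k' > 0" "\<And>q. prime q \<Longrightarrow> q dvd k' \<Longrightarrow> q > A"
proof -
  define Q where "Q = {q. prime q \<and> q \<le> A \<and> \<not> q dvd k}"
  have fin: "finite Q" by (rule finite_subset[of _ "{..A}"]) (auto simp: Q_def)
  have "0 \<notin> Q" by (auto simp: Q_def)
  hence pos: "\<Prod>Q > 0" using fin by (intro prod_pos) (auto intro: gr0I)
  show ?thesis
  proof (rule that[of "k + N * \<Prod>Q"])
    show "[k + N * \<Prod>Q = k] (mod N)" by (simp add: cong_def)
    show "k + N * \<Prod>Q > 0" using pos assms by simp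
    fix q :: nat assume q: "prime q" "q dvd k + N * \<Prod>Q"
    show "q > A"
    proof (rule ccontr)
      assume "\<not> q > A"
      hence qA: "q \<le> A" by simp
      show False
      proof (cases "q dvd k")
        case True
        hence "q dvd N * \<Prod>Q" using q(2) by (simp add: dvd_add_right_iff)
        moreover have "\<not> q dvd N"
          using True assms(1) q(1) by (metis coprime_common_divisor_nat not_prime_1 nat_dvd_1_iff_1)
        ultimately have "q dvd \<Prod>Q" using q(1) by (simp add: prime_dvd_mult_iff)
        then obtain r where "r \<in> Q" "q dvd r"
          using q(1) fin by (metis prime_dvd_prod_iff)
        thus False using True q(1) by (metis (mono_tags) Q_def mem_Collect_eq primes_dvd_imp_eq)
      next
        case False
        hence "q \<in> Q" using q qA by (simp add: Q_def)
        hence "q dvd \<Prod>Q" using dvd_prodI[OF fin, of q "\<lambda>x. x"] by simp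
        thus False using False q(2) by (simp add: dvd_add_left_iff)
      qed
    qed
  qed
qed

text \<open>For the minimal polynomial of a primitive root of unity this is the irreducibility of
  the cyclotomic polynomial. As \<open>x ^ N = 1\<close>, the exponent may be replaced by a
  congruent one with only large prime factors, and these are treated one at a time.\<close>

lemma int_poly_root_power:
  fixes x :: "'a::comm_ring_1"
  assumes f: "lead_coeff f = 1" "f dvd monom 1 N - 1" and N: "N > 0"
    and x: "int_poly_eval x f = 0" and k: "coprime k N"
  shows "int_poly_eval (x ^ k) f = 0"
proof -
  obtain A where A: "\<And>q. prime q \<Longrightarrow> q > A \<Longrightarrow> f dvd f \<circ>\<^sub>p monom 1 q"
    using dvd_pcompose_monom_large_prime[OF f N] by blast
  have step: "int_poly_eval (y ^ n) f = 0"
    if "n > 0" "\<And>q. prime q \<Longrightarrow> q dvd n \<Longrightarrow> q > A" "int_poly_eval y f = 0" for n and y :: 'a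
    using that
  proof (induction n arbitrary: y rule: less_induct)
    case (less n)
    show ?case
    proof (cases "n = 1")
      case True
      thus ?thesis using less.prems by simp
    next
      case False
      then obtain q m where q: "prime q" "n = q * m" using prime_factor_nat[of n] by (auto elim: dvdE)
      have "f dvd f \<circ>\<^sub>p monom 1 q" using A q less.prems(2) by simp
      hence "int_poly_eval y (f \<circ>\<^sub>p monom 1 q) = 0" using less.prems(3)
        by (metis (no_types) dvd_def int_poly_eval.hom_mult mult_zero_left)
      hence "int_poly_eval (y ^ q) f = 0" by (simp only: int_poly_eval_pcompose_monom)
      moreover have "m < n" "m > 0" using q less.prems(1) prime_gt_1_nat[OF q(1)] by auto
      ultimately have "int_poly_eval ((y ^ q) ^ m) f = 0"
        using less.IH[of m "y ^ q"] less.prems(2) q(2) by simp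
      thus ?thesis by (simp add: q(2) power_mult)
    qed
  qed
  obtain k' where k': "[k' = k] (mod N)" "k' > 0" "\<And>q. prime q \<Longrightarrow> q dvd k' \<Longrightarrow> q > A"
    using coprime_cong_large_prime_factors[OF k N] by blast
  have "int_poly_eval x (monom 1 N - 1) = 0"
    using f(2) x by (metis (no_types) dvd_def int_poly_eval.hom_mult mult_zero_left)
  hence "x ^ N = 1" by (simp add: hom_distribs)
  have "x ^ m = x ^ (m mod N)" for m
    by (metis \<open>x ^ N = 1\<close> mult_1 power_add power_mult power_one div_mult_mod_eq mult.commute)
  hence "x ^ k' = x ^ k" using k'(1) by (metis cong_def)
  thus ?thesis using step[OF k'(2,3) x] by simp
qed

section \<open>Primitive roots of unity\<close>

lemma primitive_root_of_unity_power_eq_1_iff: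
  assumes z: "primitive_root_of_unity n z" and n: "n > 0"
  shows "z ^ i = 1 \<longleftrightarrow> n dvd i"
proof -
  have zn: "z ^ n = 1" and min: "\<And>k. 0 < k \<Longrightarrow> k < n \<Longrightarrow> z ^ k \<noteq> 1"
    using z by (auto simp: primitive_root_of_unity_def)
  have "z ^ i = z ^ (n * (i div n) + i mod n)" by simp
  also have "\<dots> = z ^ (i mod n)" by (simp only: power_add power_mult zn power_one mult_1)
  finally show ?thesis using min[of "i mod n"] n by (auto simp: dvd_eq_mod_eq_0)
qed

lemma primitive_root_of_unity_power_eq_iff:
  assumes z: "primitive_root_of_unity n z" and n: "n > 0"
  shows "z ^ i = z ^ j \<longleftrightarrow> [i = j] (mod n)"
proof -
  have "z \<noteq> 0" using z n by (auto simp: primitive_root_of_unity_def power_0_left)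
  have *: "z ^ i = z ^ j \<longleftrightarrow> [i = j] (mod n)" if "i \<le> j" for i j
  proof -
    have "z ^ j = z ^ i * z ^ (j - i)" using that by (simp flip: power_add)
    hence "z ^ i = z ^ j \<longleftrightarrow> z ^ (j - i) = 1" using \<open>z \<noteq> 0\<close> by auto
    also have "\<dots> \<longleftrightarrow> n dvd j - i" by (rule primitive_root_of_unity_power_eq_1_iff[OF z n])
    also have "\<dots> \<longleftrightarrow> [i = j] (mod n)" using that by (metis cong_altdef_nat cong_sym_eq)
    finally show ?thesis .
  qed
  show ?thesis using *[of i j] *[of j i] by (metis cong_sym_eq linear)
qed

lemma primitive_root_of_unity_exp:
  assumes "n > 0"
  shows "primitive_root_of_unity n (exp (- 2 * of_real pi * \<i> / of_nat n) :: complex)"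
proof -
  define c where "c k = cis (2 * pi * real k / real n)" for k
  have exp: "exp (- 2 * of_real pi * \<i> / of_nat n) ^ k = inverse (c k)" for k
  proof -
    have "exp (- 2 * of_real pi * \<i> / of_nat n :: complex) ^ k
        = exp (of_nat k * (- 2 * of_real pi * \<i> / of_nat n))"
      by (simp only: exp_of_nat_mult)
    also have "\<dots> = exp (- (\<i> * of_real (2 * pi * real k / real n)))"
      by (simp add: field_simps)
    finally show ?thesis by (simp add: c_def cis_conv_exp exp_minus)
  qed
  have inj: "inj_on c {..<n}"
    using bij_betw_roots_unity[OF assms] unfolding bij_betw_def c_def by blast
  have "c 0 = 1" "c n = 1" using assms by (simp_all add: c_def)
  moreover have "c k \<noteq> 1" if "0 < k" "k < n" for k
    using inj_onD[OF inj, of k 0] that \<open>c 0 = 1\<close> by auto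
  ultimately show ?thesis unfolding primitive_root_of_unity_def exp by simp
qed

section \<open>Reduction to characteristic p\<close>

lemma diff_one_power_CHAR:
  fixes a :: "'a::comm_ring_1"
  assumes "prime CHAR('a)"
  shows "(a - 1) ^ CHAR('a) = a ^ CHAR('a) - 1"
  using freshmans_dream[OF assms refl, of "a - 1" 1] by simp

lemma int_poly_eq_0_if_many_roots:
  fixes S :: "'a::field_char_0 set"
  assumes "finite S" "degree P < card S" "\<And>x. x \<in> S \<Longrightarrow> int_poly_eval x P = 0"
  shows "P = 0"
proof (rule ccontr)
  assume "P \<noteq> 0"
  hence nz: "(of_int_poly P :: 'a poly) \<noteq> 0" by simp
  have "card S \<le> card {x. poly (of_int_poly P :: 'a poly) x = 0}"
    using assms(3) by (intro card_mono poly_roots_finite nz) (auto simp: int_poly_eval_def)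
  also have "\<dots> \<le> degree P" using card_poly_roots_bound[OF nz] by simp
  finally show False using assms(2) by simp
qed

lemma lead_coeff_monom_diff_one:
  assumes "N > 0"
  shows "lead_coeff (monom 1 N - 1 :: int poly) = 1" "degree (monom 1 N - 1 :: int poly) = N"
proof -
  have "degree (monom 1 N + (- 1) :: int poly) = degree (monom 1 N :: int poly)"
    using assms by (intro degree_add_eq_left) (simp add: degree_monom_eq)
  thus deg: "degree (monom 1 N - 1 :: int poly) = N" by (simp add: degree_monom_eq)
  show "lead_coeff (monom 1 N - 1 :: int poly) = 1" using assms unfolding deg by simp
qed

text \<open>Irreducibility of the cyclotomic polynomial makes reduction modulo a prime above \<^term>\<open>p\<close>
  well defined for every choice of \<^term>\<open>\<zeta>\<close>. That the minimal polynomial \<open>f\<close> of \<^term>\<open>\<omega>\<close> vanishes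
  at \<^term>\<open>\<zeta>\<close> is seen by comparing multiplicities: \<open>X\<^sup>N - 1 = (X\<^bsup>N'\<^esup> - 1)\<^sup>p\<close> in characteristic
  \<^term>\<open>p\<close>, whereas \<open>X\<^sup>N - 1\<close> divides \<open>f\<close> times the product of the \<open>X\<^bsup>N/q\<^esup> - 1\<close>
  with \<open>q\<close> a prime factor of \<^term>\<open>N\<close>.\<close>

lemma int_poly_eval_reduction:
  fixes \<omega> :: "'a::field_char_0" and \<zeta> :: "'b::field"
  assumes p: "prime p" "CHAR('b) = p" and N: "N = p * N'" "N' > 0" "coprime p N'"
    and \<omega>: "primitive_root_of_unity N \<omega>" and \<zeta>: "primitive_root_of_unity N' \<zeta>"
    and P: "int_poly_eval \<omega> P = 0"
  shows "int_poly_eval \<zeta> P = 0"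
proof -
  have p1: "p > 1" using p prime_gt_1_nat by blast
  have N0: "N > 0" using N p1 by simp
  note \<omega>_eq_1 = primitive_root_of_unity_power_eq_1_iff[OF \<omega> N0]
  define g :: "int poly" where "g = monom 1 N - 1"
  have g: "lead_coeff g = 1" "degree g = N"
    unfolding g_def using lead_coeff_monom_diff_one[OF N0] by auto
  have "int_poly_eval \<omega> g = 0" by (simp add: g_def hom_distribs \<omega>_eq_1)
  then obtain f where f: "lead_coeff f = 1" "int_poly_eval \<omega> f = 0"
    and f_dvd: "\<And>P. int_poly_eval \<omega> P = 0 \<Longrightarrow> f dvd P"
    using monic_int_minimal_poly[OF g(1), of \<omega>] by blast
  have fg: "f dvd monom 1 N - 1" using f_dvd \<open>int_poly_eval \<omega> g = 0\<close> by (simp add: g_def)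
  define T :: "nat \<Rightarrow> int poly" where "T q = monom 1 (N div q) - 1" for q
  \<comment> \<open>\<open>T p\<close> is left out of \<open>V\<close> because it reduces to
    \<open>t\<close>, which vanishes at \<zeta>. Cancelling one factor \<open>t\<close> from
    \<open>t ^ p\<close> still leaves \<open>t ^ (p - 1)\<close>, a positive power.\<close>
  define V where "V = f * (\<Prod>q\<in>prime_factors N - {p}. T q)"
  have p_in: "p \<in> prime_factors N" using p N0 N by (simp add: prime_factors_dvd)
  have W: "V * T p = f * (\<Prod>q\<in>prime_factors N. T q)"
    by (simp add: V_def prod.remove[OF finite_set_mset p_in] mult_ac)
  obtain Q R where QR: "V * T p = g * Q + R" "R = 0 \<or> degree R < degree g"
    by (rule monic_division[OF g(1)])
  \<comment> \<open>If \<open>i\<close> is coprime to \<open>N\<close>, the power is a root of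
    \<open>f\<close>; otherwise a common prime factor \<open>q\<close> makes it a root of
    \<open>T q\<close>.\<close>
  have root: "int_poly_eval (\<omega> ^ i) (V * T p) = 0" for i
  proof (cases "coprime i N")
    case True
    thus ?thesis unfolding W
      using int_poly_root_power[OF f(1) fg N0 f(2)] by (simp add: hom_distribs)
  next
    case False
    then obtain q where q: "prime q" "q dvd i" "q dvd N"
      using prime_factor_nat[of "gcd i N"] by (auto simp: coprime_iff_gcd_eq_1)
    hence "q \<in> prime_factors N" using N0 by (simp add: prime_factors_dvd)
    moreover have "int_poly_eval (\<omega> ^ i) (T q) = 0"
    proof -
      have "N dvd i * (N div q)" using q(2,3) by (auto elim!: dvdE)
      thus ?thesis by (simp add: T_def hom_distribs \<omega>_eq_1 flip: power_mult)
    qed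
    ultimately have "(\<Prod>q\<in>prime_factors N. int_poly_eval (\<omega> ^ i) (T q)) = 0"
      by (intro prod_zero) auto
    thus ?thesis unfolding W by (simp add: hom_distribs)
  qed
  \<comment> \<open>The remainder has degree below \<open>N\<close> but vanishes at the
    \<open>N\<close> distinct powers of \<omega>.\<close>
  have "R = 0"
  proof (rule ccontr)
    assume "R \<noteq> 0"
    hence deg: "degree R < N" using QR(2) g(2) by simp
    have "inj_on (\<lambda>i. \<omega> ^ i) {..<N}"
      using primitive_root_of_unity_power_eq_iff[OF \<omega> N0]
      by (auto simp: inj_on_def cong_def)
    hence card: "card ((\<lambda>i. \<omega> ^ i) ` {..<N}) = N" by (simp add: card_image)
    have "int_poly_eval (\<omega> ^ i) g = 0" for i
      by (simp add: g_def hom_distribs \<omega>_eq_1 flip: power_mult)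
    hence "int_poly_eval (\<omega> ^ i) R = 0" for i
      using root[of i] unfolding QR(1) by (simp add: hom_distribs)
    hence "R = 0"
      using int_poly_eq_0_if_many_roots[of "(\<lambda>i. \<omega> ^ i) ` {..<N}" R] deg card by auto
    thus False using \<open>R \<noteq> 0\<close> by simp
  qed
  define t :: "'b poly" where "t = monom 1 N' - 1"
  have Tp: "of_int_poly (T p) = t"
    using p1 by (simp add: T_def t_def N(1) hom_distribs)
  have "CHAR('b poly) = p" using p by simp
  hence "t ^ p = monom 1 N' ^ p - 1"
    using diff_one_power_CHAR[of "monom 1 N' :: 'b poly"] p by (simp add: t_def)
  also have "\<dots> = of_int_poly g"
    by (simp add: g_def N(1) monom_power hom_distribs mult.commute)
  finally have "of_int_poly (V * T p) = t ^ p * of_int_poly Q"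
    using QR(1) \<open>R = 0\<close> by (simp add: hom_distribs)
  moreover have "t ^ p = t ^ (p - 1) * t" using p1 by (simp flip: power_Suc2)
  ultimately have "of_int_poly V * t = (t ^ (p - 1) * of_int_poly Q) * t"
    by (simp add: hom_distribs Tp mult_ac)
  moreover have "t \<noteq> 0"
  proof
    assume "t = 0"
    hence "coeff t N' = 0" by simp
    thus False using N(2) by (simp add: t_def)
  qed
  ultimately have "of_int_poly V = t ^ (p - 1) * of_int_poly Q" by simp
  moreover have "poly t \<zeta> = 0"
    using \<zeta> by (simp add: t_def poly_monom primitive_root_of_unity_def)
  ultimately have "int_poly_eval \<zeta> V = 0" using p1 by (simp add: int_poly_eval_def)
  \<comment> \<open>With \<open>N' = q * m\<close> coprime to \<open>p\<close>, the order
    \<open>N'\<close> of \<zeta> cannot divide \<open>N div q = p * m\<close>.\<close>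
  moreover have "int_poly_eval \<zeta> (T q) \<noteq> 0" if "q \<in> prime_factors N - {p}" for q
  proof
    assume z: "int_poly_eval \<zeta> (T q) = 0"
    have q: "prime q" "q dvd N" "q \<noteq> p" using that by (auto simp: prime_factors_dvd)
    hence "q dvd N'" using p(1) N(1) by (auto simp: prime_dvd_mult_iff primes_dvd_imp_eq)
    then obtain m where m: "N' = q * m" by (elim dvdE)
    have q0: "q > 1" using q(1) prime_gt_1_nat by blast
    have "N div q = p * m" using q0 by (simp add: N(1) m)
    hence "\<zeta> ^ (p * m) = 1" using z by (simp add: T_def hom_distribs)
    hence "N' dvd p * m" using primitive_root_of_unity_power_eq_1_iff[OF \<zeta> N(2)] by simp
    hence "N' dvd m" using N(3) by (simp add: coprime_commute coprime_dvd_mult_right_iff)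
    hence "N' \<le> m" using N(2) m by (auto intro: dvd_imp_le)
    thus False using m q0 N(2) by simp
  qed
  ultimately have "int_poly_eval \<zeta> f = 0" by (simp add: V_def hom_distribs)
  moreover obtain h where "P = f * h" using f_dvd[OF P] by (elim dvdE)
  ultimately show ?thesis by (simp add: hom_distribs)
qed

section \<open>Sparse polynomials in positive characteristic\<close>

lemma power_dvd_pderiv:
  fixes h a :: "'a::idom poly"
  assumes "a ^ Suc m dvd h"
  shows "a ^ m dvd pderiv h"
proof -
  obtain u where "h = a ^ Suc m * u" using assms by (elim dvdE)
  hence "pderiv h = a ^ Suc m * pderiv u + u * (smult (of_nat (Suc m)) (a ^ m) * pderiv a)"
    by (simp only: pderiv_mult pderiv_power_Suc)
  moreover have "a ^ m dvd a ^ Suc m * pderiv u" by simp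
  moreover have "a ^ m dvd u * (smult (of_nat (Suc m)) (a ^ m) * pderiv a)"
    by (intro dvd_mult dvd_mult2 dvd_smult dvd_refl)
  ultimately show ?thesis by (metis dvd_add)
qed

text \<open>In characteristic \<open>p\<close>, the order of vanishing at 1 of a polynomial of degree below \<open>p\<close> is less
  than its number of terms: the operator \<open>X D - b\<close> removes the term of degree \<open>b\<close> and lowers the
  order by at most one.\<close>

lemma sparse_poly_eq_0:
  fixes h :: "'a::idom poly"
  assumes "finite B" "B \<subseteq> {..<CHAR('a)}" "\<And>i. coeff h i \<noteq> 0 \<Longrightarrow> i \<in> B"
    and "[:-1, 1:] ^ card B dvd h"
  shows "h = 0"
  using assms
proof (induction B arbitrary: h rule: finite_induct)
  case empty
  thus ?case by (auto simp: poly_eq_iff)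
next
  case (insert b B)
  define h' where "h' = [:0, 1:] * pderiv h - smult (of_nat b) h"
  have coeff_h': "coeff h' i = (of_nat i - of_nat b) * coeff h i" for i
    by (cases i) (simp_all add: h'_def coeff_pderiv algebra_simps)
  have dvd: "[:-1, 1:] ^ Suc (card B) dvd h" using insert by simp
  hence "[:-1, 1:] ^ card B dvd h" by (metis dvd_trans le_imp_power_dvd lessI less_imp_le)
  hence "[:-1, 1:] ^ card B dvd h'"
    using power_dvd_pderiv[OF dvd] unfolding h'_def by (intro dvd_diff dvd_mult dvd_smult)
  moreover have "i \<in> B" if "coeff h' i \<noteq> 0" for i
    using that insert.prems(2)[of i] by (auto simp: coeff_h')
  ultimately have "h' = 0" using insert by blast
  have zero: "coeff h i = 0" if "i \<noteq> b" for i
  proof (rule ccontr)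
    assume nz: "coeff h i \<noteq> 0"
    \<comment> \<open>Distinct exponents below the characteristic stay distinct in the ring, so only
      the term of degree \<open>b\<close> can survive.\<close>
    hence ib: "i < CHAR('a)" "b < CHAR('a)" using insert.prems(1,2) by auto
    have "coeff h' i = 0" using \<open>h' = 0\<close> by simp
    hence "of_nat i = (of_nat b :: 'a)" using nz by (simp add: coeff_h')
    hence "[i = b] (mod CHAR('a))" by (simp add: of_nat_eq_iff_cong_CHAR)
    thus False using ib that by (simp add: cong_def)
  qed
  hence h: "h = monom (coeff h b) b" by (auto simp: poly_eq_iff)
  \<comment> \<open>The remaining single term vanishes at 1, where its value is its
    coefficient.\<close>
  have "[:-1, 1:] dvd h" using dvd by (metis dvd_trans dvd_triv_left power_Suc)
  hence "poly h 1 = 0" by (simp add: poly_eq_0_iff_dvd)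
  hence "coeff h b = 0" by (subst (asm) h) (simp add: poly_monom)
  hence "monom (coeff h b) b = 0" by simp
  thus ?case using h by metis
qed

text \<open>Induction on \<open>m\<close> shows that \<open>[:-1, 1:] ^ m\<close> divides every
  \<open>h s\<close>. Taking \<open>m = n s\<close> contradicts sparsity unless
  \<open>h s = 0\<close>.\<close>

lemma fourier_sparse_system_trivial:
  fixes \<zeta> :: "'a::field" and h :: "nat \<Rightarrow> 'a poly" and n :: "nat \<Rightarrow> nat"
  assumes minors: "\<And>R. R \<subseteq> {0..<M} \<Longrightarrow> minor (fourier_matrix_of M \<zeta>) R R \<noteq> 0"
    and B: "\<And>s. s < M \<Longrightarrow> B s \<subseteq> {..<CHAR('a)}" "\<And>s. s < M \<Longrightarrow> card (B s) \<le> n s"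
    and h: "\<And>s i. s < M \<Longrightarrow> coeff (h s) i \<noteq> 0 \<Longrightarrow> i \<in> B s"
    and dvd: "\<And>r. r < M \<Longrightarrow> [:-1, 1:] ^ n r dvd (\<Sum>s<M. smult (\<zeta> ^ (r * s)) (h s))"
    and s: "s < M"
  shows "h s = 0"
proof -
  define X :: "'a poly" where "X = [:-1, 1:]"
  have X0: "X \<noteq> 0" and X_dvd: "X dvd q \<longleftrightarrow> poly q 1 = 0" for q
    by (simp_all add: X_def poly_eq_0_iff_dvd)
  note sparse_poly_eq_0 = sparse_poly_eq_0[where 'a = 'a, folded X_def] and dvd = dvd[folded X_def]
  have sparse: "h s = 0" if "s < M" "n s \<le> m" "X ^ m dvd h s" for s m
  proof (rule sparse_poly_eq_0[of "B s"])
    show "finite (B s)" using B(1)[OF that(1)] finite_subset by blast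
    have "X ^ card (B s) dvd X ^ m" using B(2)[OF that(1)] that(2) by (intro le_imp_power_dvd) simp
    thus "X ^ card (B s) dvd h s" using that(3) dvd_trans by blast
  qed (use B(1) h that(1) in blast)+
  have "\<forall>s<M. X ^ m dvd h s" for m
  proof (induction m)
    case (Suc m)
    define g where "g s = h s div X ^ m" for s
    have g: "h s = X ^ m * g s" if "s < M" for s
      unfolding g_def using Suc.IH that by (simp only: dvd_mult_div_cancel)
    \<comment> \<open>Outside \<open>R\<close> there are at most \<open>m\<close> terms, so
      \<open>h s\<close> is already zero. The rows in \<open>R\<close> admit a further factor
      \<open>X\<close>, so the values of \<open>g s\<close> at 1 form a kernel vector of a principal
      minor.\<close>
    define R where "R = {r \<in> {0..<M}. m < n r}"
    have R: "R \<subseteq> {0..<M}" by (auto simp: R_def)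
    have small: "h s = 0" if "s < M" "s \<notin> R" for s
      using sparse[of s m] that Suc.IH by (auto simp: R_def)
    have eq: "(\<Sum>s\<in>R. fourier_matrix_of M \<zeta> $$ (r, s) * poly (g s) 1) = 0" if r: "r \<in> R" for r
    proof -
      have rM: "r < M" "Suc m \<le> n r" using r by (auto simp: R_def)
      have "X ^ Suc m dvd (\<Sum>s<M. smult (\<zeta> ^ (r * s)) (h s))"
        using dvd[OF rM(1)] rM(2) by (meson dvd_trans le_imp_power_dvd)
      also have "(\<Sum>s<M. smult (\<zeta> ^ (r * s)) (h s)) = (\<Sum>s\<in>R. smult (\<zeta> ^ (r * s)) (h s))"
        using R small by (intro sum.mono_neutral_right) auto
      also have "\<dots> = X ^ m * (\<Sum>s\<in>R. smult (\<zeta> ^ (r * s)) (g s))"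
        unfolding sum_distrib_left
      proof (rule sum.cong[OF refl])
        fix s assume "s \<in> R"
        hence "s < M" using R by auto
        thus "smult (\<zeta> ^ (r * s)) (h s) = X ^ m * smult (\<zeta> ^ (r * s)) (g s)"
          by (simp only: g mult_smult_right)
      qed
      finally have "X dvd (\<Sum>s\<in>R. smult (\<zeta> ^ (r * s)) (g s))"
        using X0 by (simp add: power_Suc2 del: power_Suc)
      hence "poly (\<Sum>s\<in>R. smult (\<zeta> ^ (r * s)) (g s)) 1 = 0" by (simp add: X_dvd)
      moreover have "fourier_matrix_of M \<zeta> $$ (r, s) = \<zeta> ^ (r * s)" if "s \<in> R" for s
        using that R rM by (auto simp: fourier_matrix_of_def)
      ultimately show ?thesis by (simp add: poly_sum)
    qed
    have "fourier_matrix_of M \<zeta> \<in> carrier_mat M M" by (simp add: fourier_matrix_of_def)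
    note ker = minor_eq_0_iff_kernel[OF this R R refl]
    have g1: "poly (g s) 1 = 0" if "s \<in> R" for s
    proof (rule ccontr)
      assume "poly (g s) 1 \<noteq> 0"
      hence "minor (fourier_matrix_of M \<zeta>) R R = 0"
        unfolding ker using eq that by (intro exI[of _ "\<lambda>s. poly (g s) 1"]) blast
      thus False using minors[OF R] by simp
    qed
    show ?case
    proof (intro allI impI)
      fix s assume "s < M"
      show "X ^ Suc m dvd h s"
      proof (cases "s \<in> R")
        case True
        hence "X dvd g s" using g1 by (simp add: X_dvd)
        hence "X ^ m * X dvd X ^ m * g s" by (rule mult_dvd_mono[OF dvd_refl])
        thus ?thesis using g[OF \<open>s < M\<close>] by (metis power_Suc2)
      next
        case False
        thus ?thesis using small \<open>s < M\<close> by simp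
      qed
    qed
  qed simp
  thus ?thesis using sparse[of s "n s"] s by simp
qed

section \<open>Reduction of Fourier minors\<close>

lemma prod_linear_dvd:
  fixes H :: "'a::idom poly"
  assumes "finite A" "inj_on x A" "\<And>k. k \<in> A \<Longrightarrow> poly H (x k) = 0"
  shows "(\<Prod>k\<in>A. [:- x k, 1:]) dvd H"
  using assms
proof (induction A rule: finite_induct)
  case (insert k A)
  then obtain u where u: "H = (\<Prod>k\<in>A. [:- x k, 1:]) * u" by (auto elim: dvdE)
  have "poly (\<Prod>k\<in>A. [:- x k, 1:]) (x k) \<noteq> 0"
    using insert.hyps insert.prems(1) by (auto simp: poly_prod inj_on_def)
  moreover have "poly H (x k) = 0" using insert.prems by simp
  ultimately have "poly u (x k) = 0" unfolding u by simp
  hence "[:- x k, 1:] dvd u" by (simp add: poly_eq_0_iff_dvd)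
  hence "(\<Prod>k\<in>A. [:- x k, 1:]) * [:- x k, 1:] dvd H" unfolding u by (rule mult_dvd_mono[OF dvd_refl])
  moreover have "(\<Prod>k\<in>insert k A. [:- x k, 1:]) = (\<Prod>k\<in>A. [:- x k, 1:]) * [:- x k, 1:]"
    using insert.hyps by (simp only: prod.insert not_False_eq_True mult.commute)
  ultimately show ?case by metis
qed simp

text \<open>Remainders modulo a monic \<open>G\<close> exist over the base ring and commute with
  \<phi>. Divisibility thus becomes a linear system in \<open>w\<close> whose coefficients are
  images under \<phi>, as \<open>kernel_transfer\<close> requires.\<close>

lemma dvd_sum_monom_iff_remainders:
  fixes \<phi> :: "'r::idom \<Rightarrow> 'a::field" and G :: "'r poly"
  assumes \<phi>: "comm_ring_hom \<phi>" and G: "lead_coeff G = 1"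
    and R: "\<And>j. G dvd monom 1 j - R j" "\<And>j. R j = 0 \<or> degree (R j) < degree G"
  shows "map_poly \<phi> G dvd (\<Sum>l\<in>L. smult (\<phi> (a l) * w l) (monom 1 (b l))) \<longleftrightarrow>
    (\<forall>i<degree G. (\<Sum>l\<in>L. \<phi> (a l * coeff (R (b l)) i) * w l) = 0)"
proof -
  interpret \<phi>: comm_ring_hom \<phi> by (rule \<phi>)
  interpret \<Phi>: map_poly_comm_ring_hom \<phi> ..
  have degG: "degree (map_poly \<phi> G) = degree G"
  proof (rule degree_map_poly)
    show "\<phi> (lead_coeff G) = 0 \<longleftrightarrow> G = 0" using G by auto
  qed
  \<comment> \<open>\<open>D\<close> is the remainder of the sum modulo the image of
    \<open>G\<close>; it has no terms of degree \<open>degree G\<close> or more, so it is divisible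
    only if it is zero.\<close>
  define D where "D = (\<Sum>l\<in>L. smult (\<phi> (a l) * w l) (map_poly \<phi> (R (b l))))"
  have "map_poly \<phi> G dvd monom 1 j - map_poly \<phi> (R j)" for j
  proof -
    have "map_poly \<phi> G dvd map_poly \<phi> (monom 1 j - R j)" using R(1) by (metis \<Phi>.hom_mult dvd_def)
    thus ?thesis by (simp add: \<Phi>.hom_minus)
  qed
  hence "map_poly \<phi> G dvd (\<Sum>l\<in>L. smult (\<phi> (a l) * w l) (monom 1 (b l) - map_poly \<phi> (R (b l))))"
    by (intro dvd_sum dvd_smult)
  also have "\<dots> = (\<Sum>l\<in>L. smult (\<phi> (a l) * w l) (monom 1 (b l))) - D"
    by (simp add: D_def smult_diff_right sum_subtractf)
  finally have "map_poly \<phi> G dvd (\<Sum>l\<in>L. smult (\<phi> (a l) * w l) (monom 1 (b l))) \<longleftrightarrow> map_poly \<phi> G dvd D"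
    by (metis dvd_diff_commute dvd_diff_left_iff dvd_diff_right_iff)
  also have "\<dots> \<longleftrightarrow> (\<forall>i<degree G. coeff D i = 0)"
  proof -
    have high: "coeff D i = 0" if "\<not> i < degree G" for i
    proof -
      have "coeff (R j) i = 0" for j using R(2)[of j] that by (auto intro: coeff_eq_0)
      thus ?thesis by (simp add: D_def coeff_sum)
    qed
    show ?thesis
    proof
      assume dvd: "map_poly \<phi> G dvd D"
      have "D = 0"
      proof (rule ccontr)
        assume "D \<noteq> 0"
        hence "degree G \<le> degree D" using dvd_imp_degree_le[OF dvd] degG by simp
        hence "lead_coeff D = 0" using high by simp
        thus False using \<open>D \<noteq> 0\<close> by simp
      qed
      thus "\<forall>i<degree G. coeff D i = 0" by simp
    next
      assume "\<forall>i<degree G. coeff D i = 0"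
      hence "D = 0" using high by (auto simp: poly_eq_iff)
      thus "map_poly \<phi> G dvd D" by simp
    qed
  qed
  also have "(\<forall>i<degree G. coeff D i = 0) \<longleftrightarrow>
      (\<forall>i<degree G. (\<Sum>l\<in>L. \<phi> (a l * coeff (R (b l)) i) * w l) = 0)"
    by (simp add: D_def coeff_sum \<phi>.hom_mult mult_ac)
  finally show ?thesis .
qed

lemma map_poly_prod_linear:
  "map_poly (int_poly_eval x) (\<Prod>k\<in>A. [:- monom 1 (m k), 1:]) = (\<Prod>k\<in>A. [:- (x ^ m k), 1:])"
proof -
  interpret map_poly_comm_ring_hom "int_poly_eval x" ..
  show ?thesis by (simp add: hom_prod hom_distribs)
qed

lemma card_eq_sum_card_residues:
  fixes K :: "nat set"
  assumes "finite K" "M > 0"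
  shows "card K = (\<Sum>r<M. card {k \<in> K. k mod M = r})"
proof -
  have "(\<Sum>r<M. \<Sum>k\<in>{k \<in> K. k mod M = r}. 1) = (\<Sum>k\<in>K. 1::nat)"
    using assms by (intro sum.group) auto
  thus ?thesis by simp
qed

lemma mod_pair_eq_imp_eq:
  fixes k l :: nat
  assumes "coprime p M" "k < p * M" "l < p * M" "k mod p = l mod p" "k mod M = l mod M"
  shows "k = l"
  using assms coprime_cong_mult_nat[of k l p M] by (simp add: cong_def)

text \<open>Here \<omega> and \<zeta> are arbitrary roots of the given orders;
  \<open>int_poly_eval_reduction\<close> links any such pair.\<close>

lemma fourier_minor_nonzero:
  fixes \<zeta> :: "'b::field" and \<omega> :: "'a::field_char_0"
  assumes p: "prime p" "CHAR('b) = p" and N: "N = p * M" "M > 0" "coprime p M"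
    and \<omega>: "primitive_root_of_unity N \<omega>" and \<zeta>: "primitive_root_of_unity M \<zeta>"
    and minors: "\<And>R. R \<subseteq> {0..<M} \<Longrightarrow> minor (fourier_matrix_of M \<zeta>) R R \<noteq> 0"
    and K: "K \<subseteq> {0..<N}" and L: "L \<subseteq> {0..<N}"
    and principal: "\<And>r. r < M \<Longrightarrow> card {k \<in> K. k mod M = r} = card {l \<in> L. l mod M = r}"
  shows "minor (fourier_matrix_of N \<omega>) K L \<noteq> 0"
proof
  assume minor: "minor (fourier_matrix_of N \<omega>) K L = 0"
  have N0: "N > 0" using p N prime_gt_0_nat by simp
  have fin: "finite K" "finite L" using K L finite_subset by auto
  note \<omega>_eq = primitive_root_of_unity_power_eq_iff[OF \<omega> N0]
  note \<zeta>_eq = primitive_root_of_unity_power_eq_iff[OF \<zeta> N(2)]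
  define n where "n r = card {k \<in> K. k mod M = r}" for r
  have cardK: "card K = (\<Sum>r<M. n r)"
    unfolding n_def by (rule card_eq_sum_card_residues[OF fin(1) N(2)])
  also have "\<dots> = (\<Sum>r<M. card {l \<in> L. l mod M = r})"
    using principal by (simp add: n_def)
  also have "\<dots> = card L"
    by (rule card_eq_sum_card_residues[OF fin(2) N(2), symmetric])
  finally have card: "card K = card L" .
  have "fourier_matrix_of N \<omega> \<in> carrier_mat N N" by (simp add: fourier_matrix_of_def)
  from minor_eq_0_iff_kernel[OF this K L card] minor obtain w l0
    where l0: "l0 \<in> L" "w l0 \<noteq> 0"
      and "\<forall>k\<in>K. (\<Sum>l\<in>L. fourier_matrix_of N \<omega> $$ (k, l) * w l) = 0" by auto
  moreover have "fourier_matrix_of N \<omega> $$ (k, l) = \<omega> ^ (k * l)" if "k \<in> K" "l \<in> L" for k l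
    using subsetD[OF K that(1)] subsetD[OF L that(2)] by (simp add: fourier_matrix_of_def)
  ultimately have w: "(\<Sum>l\<in>L. \<omega> ^ (k * l) * w l) = 0" if "k \<in> K" for k
    using that by (simp cong: sum.cong)

  \<comment> \<open>\<open>e\<close> and \<open>g\<close> are the Chinese remainder idempotents:
    \<alpha> is \<open>\<omega> ^ e\<close> and \<beta> is \<open>\<omega> ^ g\<close>.\<close>
  obtain e where e: "[e = 1] (mod p)" "[e = 0] (mod M)"
    using binary_chinese_remainder_nat[OF N(3)] by blast
  obtain g where g: "[g = 0] (mod p)" "[g = 1] (mod M)"
    using binary_chinese_remainder_nat[OF N(3)] by blast

  \<comment> \<open>The inner variable stands for the root of unity, so that \<open>G r\<close> can
    be specialised both at \<omega> and at \<zeta>.\<close>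
  define G :: "nat \<Rightarrow> int poly poly" where
    "G r = (\<Prod>k\<in>{k \<in> K. k mod M = r}. [:- monom 1 (e * k), 1:])" for r
  have G: "lead_coeff (G r) = 1" for r
    unfolding G_def by (rule monic_prod) simp
  have degG: "degree (G r) = n r" for r
    unfolding G_def n_def by (subst degree_prod_eq_sum_degree) auto
  have "\<exists>R. G r dvd monom 1 j - R \<and> (R = 0 \<or> degree R < degree (G r))" for r j
    by (rule monic_division[OF G, of "monom 1 j" r]) (metis add_diff_cancel_right' dvd_triv_left)
  then obtain R where R: "\<And>r j. G r dvd monom 1 j - R r j"
      "\<And>r j. R r j = 0 \<or> degree (R r j) < degree (G r)" by metis
  define a :: "nat \<Rightarrow> nat \<Rightarrow> int poly" where "a r l = monom 1 (g * r * l)" for r l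
  \<comment> \<open>Row \<open>(r, i)\<close> extracts coefficient \<open>i\<close> of the remainder
    modulo \<open>G r\<close>. The row count, the sum of the \<open>n r\<close>, equals
    \<open>card L\<close>, so the system is square.\<close>
  define c where "c = (\<lambda>(r, i) l. a r l * coeff (R r (l mod p)) i)"
  define S where "S = Sigma {..<M} (\<lambda>r. {..<n r})"
  have S: "finite S" "card S = card L" using cardK card by (simp_all add: S_def)

  have "(\<Sum>l\<in>L. int_poly_eval \<omega> (c s l) * w l) = 0" if sS: "s \<in> S" for s
  proof -
    obtain r i where s: "s = (r, i)" "r < M" "i < n r"
      using sS unfolding S_def by blast
    define H where "H = (\<Sum>l\<in>L. smult (int_poly_eval \<omega> (a r l) * w l) (monom 1 (l mod p)))"
    have "map_poly (int_poly_eval \<omega>) (G r) dvd H"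
      unfolding G_def map_poly_prod_linear
    proof (rule prod_linear_dvd)
      show "finite {k \<in> K. k mod M = r}" using fin by simp
      show "inj_on (\<lambda>k. \<omega> ^ (e * k)) {k \<in> K. k mod M = r}"
      proof (rule inj_onI)
        fix k k' assume k: "k \<in> {k \<in> K. k mod M = r}" "k' \<in> {k \<in> K. k mod M = r}"
          and "\<omega> ^ (e * k) = \<omega> ^ (e * k')"
        hence "[e * k = e * k'] (mod p)"
          using \<omega>_eq N(1) by (metis cong_modulus_mult_nat)
        hence "[1 * k = 1 * k'] (mod p)"
          using e(1) by (meson cong_scalar_right cong_sym cong_trans)
        hence "k mod p = k' mod p" by (simp add: cong_def)
        moreover have "k < p * M" "k' < p * M" using k K N(1) by auto
        moreover have "k mod M = k' mod M" using k by simp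
        ultimately show "k = k'" using mod_pair_eq_imp_eq[OF N(3)] by blast
      qed
      fix k assume k: "k \<in> {k \<in> K. k mod M = r}"
      \<comment> \<open>The exponents are compared modulo \<open>p\<close>, where the first summand
        dies, and modulo \<open>M\<close>, where the second dies and \<open>k\<close> is congruent
        to \<open>r\<close>.\<close>
      have "\<omega> ^ (g * r * l) * \<omega> ^ (e * k * (l mod p)) = \<omega> ^ (k * l)" for l
      proof -
        have "[g * r * l + e * k * (l mod p) = 0 * r * l + 1 * k * l] (mod p)"
          using e g by (intro cong_add cong_mult) (auto simp: cong_def)
        moreover have "[g * r * l + e * k * (l mod p) = 1 * k * l + 0 * k * (l mod p)] (mod M)"
          using e g k by (intro cong_add cong_mult) (auto simp: cong_def)
        ultimately have "[g * r * l + e * k * (l mod p) = k * l] (mod N)"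
          unfolding N(1) using N(3) by (intro coprime_cong_mult_nat) simp_all
        thus ?thesis using \<omega>_eq by (simp flip: power_add)
      qed
      hence summand: "int_poly_eval \<omega> (a r l) * w l * (\<omega> ^ (e * k)) ^ (l mod p) = \<omega> ^ (k * l) * w l" for l
        by (simp add: a_def mult_ac flip: power_mult)
           (metis (no_types, opaque_lifting) mult.assoc mult.commute)
      have "poly H (\<omega> ^ (e * k)) = (\<Sum>l\<in>L. \<omega> ^ (k * l) * w l)"
        by (simp only: H_def poly_sum poly_smult poly_monom mult_1 summand)
      thus "poly H (\<omega> ^ (e * k)) = 0" using w k by simp
    qed
    thus ?thesis
      unfolding H_def
        dvd_sum_monom_iff_remainders[OF comm_ring_hom_int_poly_eval G R]
      using s degG by (simp add: c_def)
  qed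
  then obtain v where v: "\<exists>l\<in>L. v l \<noteq> 0"
      "\<And>s. s \<in> S \<Longrightarrow> (\<Sum>l\<in>L. int_poly_eval \<zeta> (c s l) * v l) = 0"
    using kernel_transfer[where \<phi> = "int_poly_eval \<omega>" and \<psi> = "int_poly_eval \<zeta>" and c = c and w = w,
        OF comm_ring_hom_int_poly_eval comm_ring_hom_int_poly_eval
        int_poly_eval_reduction[OF p N \<omega> \<zeta>] S(1) fin(2) S(2) l0] by blast

  \<comment> \<open>Columns are grouped by their class modulo \<open>M\<close>; within a class the
    exponents \<open>l mod p\<close> are distinct.\<close>
  define h where "h s = (\<Sum>l\<in>{l \<in> L. l mod M = s}. monom (v l) (l mod p))" for s
  have h0: "h s = 0" if s: "s < M" for s
  proof (rule fourier_sparse_system_trivial[where n = n and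
        B = "\<lambda>s. (\<lambda>l. l mod p) ` {l \<in> L. l mod M = s}", OF minors])
    fix s assume s: "s < M"
    show "(\<lambda>l. l mod p) ` {l \<in> L. l mod M = s} \<subseteq> {..<CHAR('b)}"
      using p prime_gt_0_nat by auto
    show "card ((\<lambda>l. l mod p) ` {l \<in> L. l mod M = s}) \<le> n s"
      unfolding n_def principal[OF s] using fin by (intro card_image_le) simp
    fix i assume "coeff (h s) i \<noteq> 0"
    then obtain l where "l \<in> {l \<in> L. l mod M = s}" "coeff (monom (v l) (l mod p)) i \<noteq> 0"
      unfolding h_def coeff_sum by (meson sum.not_neutral_contains_not_neutral)
    thus "i \<in> (\<lambda>l. l mod p) ` {l \<in> L. l mod M = s}" by (auto split: if_splits)
  next
    fix r assume r: "r < M"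
    \<comment> \<open>\<open>M\<close> divides \<open>e\<close>, so at \<zeta> all roots of
      \<open>G r\<close> collapse to 1.\<close>
    have "\<zeta> ^ (e * k) = 1" for k
      using e(2) \<zeta>_eq[of "e * k" 0] by (simp add: cong_0_iff)
    hence "map_poly (int_poly_eval \<zeta>) (G r) = [:-1, 1:] ^ n r"
      by (simp add: G_def map_poly_prod_linear n_def)
    moreover have "map_poly (int_poly_eval \<zeta>) (G r) dvd
        (\<Sum>l\<in>L. smult (int_poly_eval \<zeta> (a r l) * v l) (monom 1 (l mod p)))"
      unfolding dvd_sum_monom_iff_remainders[OF comm_ring_hom_int_poly_eval G R]
      using v(2)[of "(r, _)"] r degG by (simp add: c_def S_def)
    moreover have "(\<Sum>l\<in>L. smult (int_poly_eval \<zeta> (a r l) * v l) (monom 1 (l mod p)))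
        = (\<Sum>s<M. smult (\<zeta> ^ (r * s)) (h s))"
    proof -
      have "(\<Sum>s<M. smult (\<zeta> ^ (r * s)) (h s))
          = (\<Sum>s<M. \<Sum>l\<in>{l \<in> L. l mod M = s}. smult (int_poly_eval \<zeta> (a r l) * v l) (monom 1 (l mod p)))"
      proof (rule sum.cong[OF refl])
        fix s
        have "smult (int_poly_eval \<zeta> (a r l) * v l) (monom 1 (l mod p))
            = smult (\<zeta> ^ (r * s)) (monom (v l) (l mod p))" if "l mod M = s" for l
        proof -
          have "[g * r * l = 1 * r * s] (mod M)"
            using g that by (intro cong_mult) (auto simp: cong_def)
          hence "\<zeta> ^ (g * r * l) = \<zeta> ^ (r * s)" using \<zeta>_eq by simp
          thus ?thesis by (simp add: a_def smult_monom)
        qed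
        thus "smult (\<zeta> ^ (r * s)) (h s)
          = (\<Sum>l\<in>{l \<in> L. l mod M = s}. smult (int_poly_eval \<zeta> (a r l) * v l) (monom 1 (l mod p)))"
          by (simp add: h_def smult_sum2)
      qed
      also have "\<dots> = (\<Sum>l\<in>L. smult (int_poly_eval \<zeta> (a r l) * v l) (monom 1 (l mod p)))"
        using fin N(2) by (intro sum.group) auto
      finally show ?thesis by simp
    qed
    ultimately show "[:-1, 1:] ^ n r dvd (\<Sum>s<M. smult (\<zeta> ^ (r * s)) (h s))" by simp
  qed (use s in simp_all)
  \<comment> \<open>By the Chinese remainder theorem, \<open>v l\<close> alone contributes to the
    coefficient of \<open>h (l mod M)\<close> at \<open>l mod p\<close>.\<close>
  have "v l = 0" if l: "l \<in> L" for l
  proof -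
    have "0 = coeff (h (l mod M)) (l mod p)" using h0 N(2) by simp
    also have "\<dots> = (\<Sum>l'\<in>{l' \<in> L. l' mod M = l mod M}. if l' = l then v l' else 0)"
      unfolding h_def coeff_sum
      using L l N by (intro sum.cong) (auto dest!: mod_pair_eq_imp_eq[OF N(3), rotated 2])
    also have "\<dots> = v l" using l fin by simp
    finally show ?thesis by simp
  qed
  thus False using v(1) by blast
qed

theorem theorem1p4:
  fixes N N' p :: nat and \<zeta> :: "'f::{field,finite}"
  assumes "prime p" and "N = p * N'" and "squarefree N"
    and "CARD('f) = p ^ ord N' p" and "primitive_root_of_unity N' \<zeta>"
    and "\<forall>K \<subseteq> {0..<N'}. minor (fourier_matrix_of N' \<zeta>) K K \<noteq> 0"
  shows "(\<forall>K \<subseteq> {0..<N}. \<forall>L \<subseteq> {0..<N}.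
            card K = card L \<and> d_principal N' K L \<longrightarrow> minor (fourier_matrix N) K L \<noteq> 0)
       \<and> (\<forall>K \<subseteq> {0..<N}. minor (fourier_matrix N) K K \<noteq> 0)"
proof -
  have N0: "N > 0" using assms(3) by (auto intro: gr0I)
  hence N': "N' > 0" using assms(2) by auto
  have "\<not> p dvd N'"
  proof
    assume "p dvd N'"
    hence "p\<^sup>2 dvd N" using assms(2) by (simp add: power2_eq_square mult_dvd_mono)
    thus False using assms(1,3) by (auto simp: squarefree_def)
  qed
  hence cop: "coprime p N'" using assms(1) by (simp add: prime_imp_coprime)
  have "CHAR('f) dvd p ^ ord N' p" using CHAR_dvd_CARD[where ?'a = 'f] assms(4) by simp
  then obtain m where "CHAR('f) = p ^ m" using assms(1) by (metis divides_primepow_nat)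
  moreover have "prime CHAR('f)"
    by (rule prime_CHAR_semidom) (use finite_imp_CHAR_pos[where ?'a = 'f] in simp)
  ultimately have char: "CHAR('f) = p" by (simp add: prime_power_iff)
  have main: "minor (fourier_matrix N) K L \<noteq> 0"
    if "K \<subseteq> {0..<N}" "L \<subseteq> {0..<N}" "d_principal N' K L" for K L
    unfolding fourier_matrix_def
  proof (rule fourier_minor_nonzero[OF assms(1) char assms(2) N' cop
        primitive_root_of_unity_exp[OF N0] assms(5) _ that(1,2)])
    show "card {k \<in> K. k mod N' = r} = card {l \<in> L. l mod N' = r}" if "r < N'" for r
      using \<open>d_principal N' K L\<close> that by (simp add: d_principal_def cong_def)
  qed (use assms(6) in blast)
  thus ?thesis by (auto simp: d_principal_def)
qed

end
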